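(* Let $d\ge1$, $1\le p<\infty$, and let $\nu:\mathbb{R}^d\setminus\{0\}\to[0,\infty)$ be measurable with $\int_{\mathbb{R}^d}(1\wedge|h|^p)\,\nu(h)\,dh<\infty$. Let $w(r)=(r\,\nu^\#(r))^{1/p}$ (see context), assume that $w$ is invertible from $[0,\infty)$ to $[0,\infty)$, let $\phi(t)=1/w^{-1}(1/t)$, and assume that $t\mapsto\phi(t^{1/p})$ is a Young function. Assume there is a universal constant $\Theta>0$ such that for all balls $B\subset\mathbb{R}^d$ the following Poincaré–Sobolev inequality holds: $$\Big\|u-\frac1{|B|}\int_Bu\Big\|_{L^\phi(B)}\le\Theta\Big(\int_B\int_B|u(x)-u(y)|^p\nu(x-y)\,dy\,dx\Big)^{1/p}\quad\text{for all }u\in L^\phi(B).$$ Then $$\|u\|_{L^\phi(\mathbb{R}^d)}\le\Theta\Big(\int_{\mathbb{R}^d}\int_{\mathbb{R}^d}|u(x)-u(y)|^p\nu(x-y)\,dy\,dx\Big)^{1/p}\quad\text{for all }u\in L^\phi(\mathbb{R}^d).$$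
   Context: $a\wedge b=\min(a,b)$; $|E|$ is Lebesgue measure, $c_d=|B(0,1)|$, $\eta(r)=(r/c_d)^{1/d}$. The symmetric decreasing rearrangement of $\nu$ is the radial function $\nu^*(\rho)=\inf\{s>0:|\{\nu>s\}|\le c_d\rho^d\}$, $\rho\ge0$. Define $\nu^\#(r)=\int_{\{\nu<\nu^*(\eta(r))\}}\nu(h)\,dh$, $w(r)=(r\,\nu^\#(r))^{1/p}$ for $r>0$, $w(0)=0$, and $\phi(t)=1/w^{-1}(1/t)$ for $t>0$, $\phi(0)=0$. A Young function is a convex function $\phi:[0,\infty]\to[0,\infty]$ with $\phi(0)=0$, not identically $0$ and not identically $\infty$ on $(0,\infty)$. For measurable $D\subset\mathbb{R}^d$, $L^\phi(D)$ is the Orlicz space of measurable $u:D\to\mathbb{R}$ with $\int_D\phi(|u|/\lambda)\,dx<\infty$ for some $\lambda>0$, with Luxemburg norm $\|u\|_{L^\phi(D)}=\inf\{\lambda>0:\int_D\phi(|u|/\lambda)\,dx\le1\}$. Right-hand sides may be $+\infty$. *)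

theory Defs
  imports "HOL-Analysis.Analysis"
begin

text \<open>Real powers on \<open>[0,\<infinity>]\<close> with \<open>\<infinity>\<close> mapped to \<open>\<infinity>\<close>; only used for exponents \<open>a > 0\<close>.\<close>

definition ennreal_powr :: "ennreal \<Rightarrow> real \<Rightarrow> ennreal" where
  "ennreal_powr x a = (if x = top then top else ennreal (enn2real x powr a))"

text \<open>A kernel on \<open>\<real>\<^sup>d - {0}\<close> is a function on the whole space; no definition depends on its
  value at \<open>0\<close>.
  The infimum is taken in \<open>[0,\<infinity>]\<close>, so that it is \<open>\<infinity>\<close> for the empty set
  (possible at \<open>\<rho> = 0\<close>).\<close>

definition unit_ball_measure :: "'a::euclidean_space itself \<Rightarrow> real" where
  "unit_ball_measure _ = measure lebesgue (ball (0::'a) 1)"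

definition rearrangement :: "('a::euclidean_space \<Rightarrow> real) \<Rightarrow> real \<Rightarrow> ennreal" where
  "rearrangement \<nu> \<rho> =
     (INF s \<in> {s::real. 0 < s \<and> emeasure lebesgue {h. h \<noteq> 0 \<and> s < \<nu> h}
                          \<le> ennreal (unit_ball_measure TYPE('a) * \<rho> ^ DIM('a))}. ennreal s)"

definition eta :: "'a::euclidean_space itself \<Rightarrow> real \<Rightarrow> real" where
  "eta T r = (r / unit_ball_measure T) powr (1 / real DIM('a))"

definition nu_sharp :: "('a::euclidean_space \<Rightarrow> real) \<Rightarrow> real \<Rightarrow> ennreal" where
  "nu_sharp \<nu> r =
     (\<integral>\<^sup>+h \<in> {h. h \<noteq> 0 \<and> ennreal (\<nu> h) < rearrangement \<nu> (eta TYPE('a) r)}. ennreal (\<nu> h) \<partial>lebesgue)"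

definition w_fun :: "('a::euclidean_space \<Rightarrow> real) \<Rightarrow> real \<Rightarrow> real \<Rightarrow> ennreal" where
  "w_fun \<nu> p r = (if r = 0 then 0 else ennreal_powr (ennreal r * nu_sharp \<nu> r) (1 / p))"

text \<open>\<open>{..<top}\<close> is \<open>[0,\<infinity>)\<close> inside \<open>[0,\<infinity>]\<close>.\<close>

definition w_invertible :: "('a::euclidean_space \<Rightarrow> real) \<Rightarrow> real \<Rightarrow> bool" where
  "w_invertible \<nu> p \<longleftrightarrow> bij_betw (w_fun \<nu> p) {0..} {..<top}"

text \<open>The division is that of \<open>[0,\<infinity>]\<close>, with \<open>1 / 0 = \<infinity>\<close> and \<open>1 / \<infinity> = 0\<close>. For invertible \<open>w\<close>
  this gives the value \<open>\<infinity>\<close> at \<open>\<infinity>\<close>, since \<open>w 0 = 0\<close>.\<close>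

definition phi :: "('a::euclidean_space \<Rightarrow> real) \<Rightarrow> real \<Rightarrow> ennreal \<Rightarrow> ennreal" where
  "phi \<nu> p t = (if t = 0 then 0 else 1 / ennreal (inv_into {0..} (w_fun \<nu> p) (1 / t)))"

definition young_function :: "(ennreal \<Rightarrow> ennreal) \<Rightarrow> bool" where
  "young_function \<Phi> \<longleftrightarrow>
     \<Phi> 0 = 0 \<and>
     (\<forall>s t a b. a + b = 1 \<longrightarrow> \<Phi> (a * s + b * t) \<le> a * \<Phi> s + b * \<Phi> t) \<and>
     (\<exists>t. 0 < t \<and> t < top \<and> \<Phi> t \<noteq> 0) \<and>
     (\<exists>t. 0 < t \<and> t < top \<and> \<Phi> t \<noteq> top)"

definition orlicz_modular ::
  "(ennreal \<Rightarrow> ennreal) \<Rightarrow> 'a::euclidean_space set \<Rightarrow> ('a \<Rightarrow> real) \<Rightarrow> real \<Rightarrow> ennreal" where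
  "orlicz_modular \<Phi> D u \<kappa> = (\<integral>\<^sup>+x. \<Phi> (ennreal (\<bar>u x\<bar> / \<kappa>)) \<partial>lebesgue_on D)"

definition orlicz_space :: "(ennreal \<Rightarrow> ennreal) \<Rightarrow> 'a::euclidean_space set \<Rightarrow> ('a \<Rightarrow> real) set" where
  "orlicz_space \<Phi> D =
     {u \<in> borel_measurable (lebesgue_on D). \<exists>\<kappa>>0. orlicz_modular \<Phi> D u \<kappa> < \<infinity>}"

definition luxemburg_norm :: "(ennreal \<Rightarrow> ennreal) \<Rightarrow> 'a::euclidean_space set \<Rightarrow> ('a \<Rightarrow> real) \<Rightarrow> ennreal" where
  "luxemburg_norm \<Phi> D u = (INF \<kappa> \<in> {\<kappa>. 0 < \<kappa> \<and> orlicz_modular \<Phi> D u \<kappa> \<le> 1}. ennreal \<kappa>)"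

definition average :: "'a::euclidean_space set \<Rightarrow> ('a \<Rightarrow> real) \<Rightarrow> real" where
  "average B u = (1 / measure lebesgue B) * (\<integral>x. u x \<partial>lebesgue_on B)"

definition nonlocal_energy ::
  "('a::euclidean_space \<Rightarrow> real) \<Rightarrow> real \<Rightarrow> 'a set \<Rightarrow> ('a \<Rightarrow> real) \<Rightarrow> ennreal" where
  "nonlocal_energy \<nu> p D u =
     (\<integral>\<^sup>+x. (\<integral>\<^sup>+y. ennreal (\<bar>u x - u y\<bar> powr p * \<nu> (x - y)) \<partial>lebesgue_on D) \<partial>lebesgue_on D)"

end

theory Submission
  imports Defs
begin

text \<open>
  Functions in \<open>L\<^sup>\<phi>(\<real>\<^sup>d)\<close> have vanishing averages over the balls \<open>B(0, r)\<close> as \<open>r \<rightarrow> \<infinity>\<close>: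
  convexity of \<open>t \<mapsto> \<phi>(t\<^bsup>1/p\<^esup>)\<close> yields \<open>\<phi>(s) \<le> (s/t) \<phi>(t)\<close> for \<open>s \<le> t\<close>, so outside \<open>{\<bar>u\<bar> \<le> \<epsilon>}\<close>
  the function \<open>\<bar>u\<bar>\<close> is dominated by a multiple of the integrable function \<open>\<phi>(\<bar>u\<bar>/\<kappa>)\<close>.
  Fatou's lemma then passes the Poincare-Sobolev inequalities on \<open>B(0, r)\<close> to the limit.
\<close>

section \<open>Monotonicity and measurability of the Orlicz integrand\<close>

lemma borel_measurable_mono_ennreal:
  fixes f :: "real \<Rightarrow> ennreal"
  assumes "mono f"
  shows "f \<in> borel_measurable borel"
proof (rule borel_measurableI_greater)
  fix y
  show "{x \<in> space borel. y < f x} \<in> sets borel"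
  proof (rule real_interval_borel_measurable)
    show "is_interval {x \<in> space borel. y < f x}"
      unfolding is_interval_1 using assms by (auto dest: monoD intro: less_le_trans)
  qed
qed

text \<open>The factor \<open>s / t\<close> is at most 1. The assumption \<open>star\<close> is what
  convexity together with \<open>\<Phi> 0 = 0\<close> gives on finite arguments: the slope from the
  origin is nondecreasing.\<close>

lemma star_shaped_mono:
  fixes \<Phi> :: "ennreal \<Rightarrow> ennreal"
  assumes star: "\<And>s t. 0 \<le> s \<Longrightarrow> s \<le> t \<Longrightarrow> 0 < t \<Longrightarrow> \<Phi> (ennreal s) \<le> ennreal (s / t) * \<Phi> (ennreal t)"
    and st: "0 \<le> s" "s \<le> t"
  shows "\<Phi> (ennreal s) \<le> \<Phi> (ennreal t)"
proof (cases "0 < t")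
  case True
  then have "\<Phi> (ennreal s) \<le> ennreal (s / t) * \<Phi> (ennreal t)"
    using star st by blast
  also have "\<dots> \<le> 1 * \<Phi> (ennreal t)"
    using True st by (intro mult_right_mono) (auto simp flip: ennreal_1 intro!: ennreal_leI)
  finally show ?thesis by simp
next
  case False
  then have "s = t" using st by simp
  then show ?thesis by simp
qed

lemma orlicz_integrand_measurable:
  fixes \<Phi> :: "ennreal \<Rightarrow> ennreal" and u :: "'a \<Rightarrow> real"
  assumes mono: "\<And>s t. 0 \<le> s \<Longrightarrow> s \<le> t \<Longrightarrow> \<Phi> (ennreal s) \<le> \<Phi> (ennreal t)"
    and u: "u \<in> borel_measurable M"
  shows "(\<lambda>x. \<Phi> (ennreal (\<bar>u x\<bar> / \<kappa>))) \<in> borel_measurable M"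
proof -
  \<comment> \<open>\<open>mono\<close> ranges over all reals, while monotonicity is known only for
    nonnegative arguments. Truncation at 0 bridges the gap and changes nothing, since
    \<open>ennreal\<close> sends negative reals to 0.\<close>
  have "mono (\<lambda>t. \<Phi> (ennreal (max 0 t)))"
    by (intro monoI mono) auto
  then have "(\<lambda>t. \<Phi> (ennreal (max 0 t))) \<in> borel_measurable borel"
    by (rule borel_measurable_mono_ennreal)
  moreover have "(\<lambda>x. \<bar>u x\<bar> / \<kappa>) \<in> borel_measurable M"
    using u by measurable
  ultimately have "(\<lambda>x. \<Phi> (ennreal (max 0 (\<bar>u x\<bar> / \<kappa>)))) \<in> borel_measurable M"
    by (rule measurable_compose[rotated])
  moreover have "ennreal (max 0 t) = ennreal t" for t
    by (cases "0 \<le> t") (auto simp: max_def ennreal_neg)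
  ultimately show ?thesis by simp
qed

section \<open>Monotonicity in the domain\<close>

lemma orlicz_modular_restrict:
  "D \<in> sets lebesgue \<Longrightarrow>
     orlicz_modular \<Phi> D u \<kappa> = (\<integral>\<^sup>+x. \<Phi> (ennreal (\<bar>u x\<bar> / \<kappa>)) * indicator D x \<partial>lebesgue)"
  by (simp add: orlicz_modular_def nn_integral_restrict_space)

lemma orlicz_modular_mono_set:
  assumes "D \<in> sets lebesgue" "E \<in> sets lebesgue" "D \<subseteq> E"
  shows "orlicz_modular \<Phi> D u \<kappa> \<le> orlicz_modular \<Phi> E u \<kappa>"
  unfolding orlicz_modular_restrict[OF assms(1)] orlicz_modular_restrict[OF assms(2)]
  using assms(3) by (intro nn_integral_mono) (auto simp: indicator_def)

lemma orlicz_space_subset: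
  assumes "u \<in> orlicz_space \<Phi> E" "D \<in> sets lebesgue" "E \<in> sets lebesgue" "D \<subseteq> E"
  shows "u \<in> orlicz_space \<Phi> D"
  using assms
  by (auto simp: orlicz_space_def intro: measurable_restrict_mono
      le_less_trans[OF orlicz_modular_mono_set[OF assms(2-4)]])

lemma nonlocal_energy_mono_set:
  fixes u :: "'a::euclidean_space \<Rightarrow> real"
  assumes "D \<in> sets lebesgue" "E \<in> sets lebesgue" "D \<subseteq> E"
  shows "nonlocal_energy \<nu> p D u \<le> nonlocal_energy \<nu> p E u"
proof -
  \<comment> \<open>Serves twice: for the inner integral at fixed \<open>x\<close>, then for the
    outer one.\<close>
  have mono: "(\<integral>\<^sup>+x. f x \<partial>lebesgue_on D) \<le> (\<integral>\<^sup>+x. g x \<partial>lebesgue_on E)"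
    if "\<And>x. f x \<le> g x" for f g :: "'a \<Rightarrow> ennreal"
    using assms that
    by (simp add: nn_integral_restrict_space) (intro nn_integral_mono mult_mono, auto simp: indicator_def)
  show ?thesis
    unfolding nonlocal_energy_def by (intro mono order_refl)
qed

lemma ennreal_powr_mono:
  assumes "x \<le> y" "0 \<le> a"
  shows "ennreal_powr x a \<le> ennreal_powr y a"
  using assms unfolding ennreal_powr_def
  by (auto simp: top_unique less_top intro!: ennreal_leI powr_mono2 enn2real_mono)

section \<open>Averages over large balls\<close>

lemma average_ball_tendsto_0:
  fixes u :: "'a::euclidean_space \<Rightarrow> real"
  assumes star: "\<And>s t. 0 \<le> s \<Longrightarrow> s \<le> t \<Longrightarrow> 0 < t \<Longrightarrow> \<Phi> (ennreal s) \<le> ennreal (s / t) * \<Phi> (ennreal t)"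
    and pos: "\<And>t. 0 < t \<Longrightarrow> 0 < \<Phi> (ennreal t)"
    and u: "u \<in> orlicz_space \<Phi> UNIV"
  shows "(\<lambda>n. average (ball 0 (real (Suc n))) u) \<longlonglongrightarrow> 0"
proof (rule LIMSEQ_I)
  fix e :: real assume "0 < e"
  \<comment> \<open>One half of \<open>e\<close> pays for the truncation level, the other for the
    remainder \<open>C\<close> divided by the volume.\<close>
  define \<epsilon> where "\<epsilon> = e / 2"
  have \<epsilon>: "0 < \<epsilon>" using \<open>0 < e\<close> by (simp add: \<epsilon>_def)
  obtain \<kappa> where \<kappa>: "0 < \<kappa>" and fin: "orlicz_modular \<Phi> UNIV u \<kappa> < \<infinity>"
    using u by (auto simp: orlicz_space_def)
  define m where "m = enn2real (orlicz_modular \<Phi> UNIV u \<kappa>)"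
  have m: "orlicz_modular \<Phi> UNIV u \<kappa> = ennreal m" "0 \<le> m"
    using fin by (auto simp: m_def)
  \<comment> \<open>\<open>\<Phi>\<close> may be infinite at \<open>\<epsilon> / \<kappa>\<close>.
    The minimum with 1 yields a finite lower bound, positive by \<open>pos\<close>.\<close>
  define c where "c = enn2real (min 1 (\<Phi> (ennreal (\<epsilon> / \<kappa>))))"
  have c_enn: "ennreal c = min 1 (\<Phi> (ennreal (\<epsilon> / \<kappa>)))"
    unfolding c_def by (rule ennreal_enn2real) (simp add: min_less_iff_disj)
  have c_le: "ennreal c \<le> \<Phi> (ennreal (\<epsilon> / \<kappa>))" by (simp add: c_enn)
  have c: "0 < c"
    using pos[of "\<epsilon> / \<kappa>"] \<epsilon> \<kappa> c_enn by (metis divide_pos_pos ennreal_less_zero_iff min_less_iff_conj zero_less_one)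
  \<comment> \<open>The integral over the whole space of the second term in \<open>ptw\<close>,
    hence a constant independent of the radius.\<close>
  define C where "C = \<epsilon> / c * m"
  have C: "0 \<le> C" using m(2) c \<epsilon> by (simp add: C_def)
  have ptw: "ennreal \<bar>u x\<bar> \<le> ennreal \<epsilon> + ennreal (\<epsilon> / c) * \<Phi> (ennreal (\<bar>u x\<bar> / \<kappa>))" for x
  proof (cases "\<bar>u x\<bar> \<le> \<epsilon>")
    case True
    then have "ennreal \<bar>u x\<bar> \<le> ennreal \<epsilon>" by (rule ennreal_leI)
    then show ?thesis by (simp add: add_increasing2)
  next
    case False
    \<comment> \<open>\<open>star\<close> compares \<open>\<epsilon> / \<kappa>\<close> with the
      larger argument \<open>\<bar>u x\<bar> / \<kappa>\<close>. Multiplying by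
      \<open>\<bar>u x\<bar> / c\<close> then isolates \<open>\<bar>u x\<bar>\<close>.\<close>
    have "ennreal c \<le> ennreal ((\<epsilon> / \<kappa>) / (\<bar>u x\<bar> / \<kappa>)) * \<Phi> (ennreal (\<bar>u x\<bar> / \<kappa>))"
      using False \<epsilon> \<kappa> by (intro order_trans[OF c_le] star) (auto simp: divide_right_mono)
    then have "ennreal (\<bar>u x\<bar> / c) * ennreal c
        \<le> ennreal (\<bar>u x\<bar> / c) * (ennreal ((\<epsilon> / \<kappa>) / (\<bar>u x\<bar> / \<kappa>)) * \<Phi> (ennreal (\<bar>u x\<bar> / \<kappa>)))"
      by (rule mult_left_mono) simp
    also have "\<dots> = ennreal (\<epsilon> / c) * \<Phi> (ennreal (\<bar>u x\<bar> / \<kappa>))"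
      using False \<epsilon> \<kappa> c by (simp add: mult.assoc[symmetric] flip: ennreal_mult'')
    finally have "ennreal \<bar>u x\<bar> \<le> ennreal (\<epsilon> / c) * \<Phi> (ennreal (\<bar>u x\<bar> / \<kappa>))"
      using c by (simp flip: ennreal_mult'')
    then show ?thesis by (simp add: add_increasing)
  qed
  have bound: "\<bar>average (ball 0 r) u\<bar> \<le> \<epsilon> + C / measure lebesgue (ball (0::'a) r)" if r: "0 < r" for r
  proof -
    let ?M = "lebesgue_on (ball (0::'a) r)" and ?v = "measure lebesgue (ball (0::'a) r)"
    have v: "0 < ?v" using r content_ball_pos[of r "0::'a"] by (simp add: measure_completion)
    have emv: "emeasure ?M (ball 0 r) = ennreal ?v"
    proof -
      have "emeasure ?M (ball 0 r) = emeasure lebesgue (ball (0::'a) r)"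
        by (simp add: emeasure_restrict_space)
      also have "\<dots> = ennreal ?v"
        by (rule emeasure_eq_ennreal_measure) (use fmeasurableD2[OF lmeasurable_ball] in blast)
      finally show ?thesis .
    qed
    have u_ball: "u \<in> orlicz_space \<Phi> (ball 0 r)"
      by (rule orlicz_space_subset[OF u]) auto
    have "ennreal \<bar>\<integral>x. u x \<partial>?M\<bar> \<le> (\<integral>\<^sup>+x. ennreal \<bar>u x\<bar> \<partial>?M)"
    \<comment> \<open>A non-integrable function has Bochner integral 0 by convention, so the bound
      is trivial in that case.\<close>
    proof (cases "integrable ?M u")
      case True
      then show ?thesis using integral_norm_bound_ennreal[of ?M u] by simp
    qed (simp add: not_integrable_integral_eq)
    also have "\<dots> \<le> (\<integral>\<^sup>+x. ennreal \<epsilon> + ennreal (\<epsilon> / c) * \<Phi> (ennreal (\<bar>u x\<bar> / \<kappa>)) \<partial>?M)"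
      by (intro nn_integral_mono ptw)
    also have "\<dots> = ennreal \<epsilon> * ennreal ?v + ennreal (\<epsilon> / c) * orlicz_modular \<Phi> (ball 0 r) u \<kappa>"
    proof -
      have [measurable]: "(\<lambda>x. \<Phi> (ennreal (\<bar>u x\<bar> / \<kappa>))) \<in> borel_measurable ?M"
        using u_ball by (intro orlicz_integrand_measurable star_shaped_mono[OF star])
          (auto simp: orlicz_space_def)
      show ?thesis
        by (simp add: nn_integral_add nn_integral_cmult emv orlicz_modular_def)
    qed
    also have "\<dots> \<le> ennreal \<epsilon> * ennreal ?v + ennreal (\<epsilon> / c) * ennreal m"
      unfolding m(1)[symmetric] by (intro add_left_mono mult_left_mono orlicz_modular_mono_set) auto
    also have "\<dots> = ennreal (\<epsilon> * ?v + C)"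
      using \<epsilon> c m(2) v by (simp add: C_def ennreal_mult del: times_divide_eq_left)
    finally have "\<bar>\<integral>x. u x \<partial>?M\<bar> \<le> \<epsilon> * ?v + C"
      using v C \<epsilon> by (subst (asm) ennreal_le_iff) auto
    then show ?thesis
      using v by (simp add: average_def abs_mult field_simps)
  qed
  \<comment> \<open>The volume grows like the \<open>DIM('a)\<close>-th power of the radius, and the
    dimension is positive. \<open>Suc n\<close> keeps the radius positive at
    \<open>n = 0\<close>.\<close>
  have "filterlim (\<lambda>n. unit_ball_vol (real DIM('a)) * real (Suc n) ^ DIM('a)) at_top sequentially"
    by (intro filterlim_tendsto_pos_mult_at_top[OF tendsto_const] filterlim_pow_at_top
        filterlim_compose[OF filterlim_real_sequentially filterlim_Suc]) auto
  then have "(\<lambda>n. C / measure lebesgue (ball (0::'a) (real (Suc n)))) \<longlonglongrightarrow> 0"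
    by (intro tendsto_divide_0[OF tendsto_const] filterlim_at_top_imp_at_infinity)
      (simp add: content_ball)
  then have "\<forall>\<^sub>F n in sequentially. C / measure lebesgue (ball (0::'a) (real (Suc n))) < \<epsilon>"
    using \<epsilon> by (rule order_tendstoD(2))
  then have "\<forall>\<^sub>F n in sequentially. \<bar>average (ball 0 (real (Suc n))) u\<bar> < e"
  proof (rule eventually_mono)
    fix n
    assume "C / measure lebesgue (ball (0::'a) (real (Suc n))) < \<epsilon>"
    then show "\<bar>average (ball 0 (real (Suc n))) u\<bar> < e"
      using bound[OF of_nat_0_less_iff[THEN iffD2, OF zero_less_Suc[of n]]] \<epsilon>_def by linarith
  qed
  then show "\<exists>N. \<forall>n\<ge>N. norm (average (ball 0 (real (Suc n))) u - 0) < e"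
    by (simp add: eventually_sequentially)
qed

section \<open>Passage to the limit in the Luxemburg norm\<close>

text \<open>Fatou's lemma applies to the modulars once the integrands are extended by zero outside
  the balls. The balls exhaust the space and the constants \<open>c n\<close> disappear in the
  limit.\<close>

lemma luxemburg_norm_UNIV_le:
  fixes u :: "'a::euclidean_space \<Rightarrow> real"
  assumes mono: "\<And>s t. 0 \<le> s \<Longrightarrow> s \<le> t \<Longrightarrow> \<Phi> (ennreal s) \<le> \<Phi> (ennreal t)"
    and u: "u \<in> borel_measurable lebesgue"
    and c: "c \<longlonglongrightarrow> 0"
    and bound: "\<And>n. luxemburg_norm \<Phi> (ball 0 (real (Suc n))) (\<lambda>x. u x - c n) \<le> K"
  shows "luxemburg_norm \<Phi> UNIV u \<le> K"
proof (rule dense_ge)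
  fix K' assume K': "K < K'"
  \<comment> \<open>Two finite levels \<open>k < l\<close> are placed strictly between
    \<open>K\<close> and \<open>K'\<close>: the modulars on the balls are controlled at level
    \<open>k\<close>, the limiting modular at level \<open>l\<close>.\<close>
  then obtain L where L: "K < L" "L < K'" using dense by blast
  obtain l where l: "L = ennreal l" "0 \<le> l"
    using L(2) by (cases L) auto
  have "K < ennreal l" using L l by simp
  then obtain M where M: "K < M" "M < ennreal l" using dense by blast
  obtain k where k: "M = ennreal k" "0 \<le> k"
    using M(2) by (cases M) auto
  have "k \<noteq> 0" using M(1) k by auto
  then have kl: "0 < k" "k < l" using M(2) k l by (auto simp: ennreal_less_iff)
  have mod: "orlicz_modular \<Phi> (ball 0 (real (Suc n))) (\<lambda>x. u x - c n) k \<le> 1" for n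
  proof -
    \<comment> \<open>The norm is an infimum that need not be attained. Strict inequality supplies
      an admissible \<open>\<kappa>\<close> below \<open>k\<close>, and enlarging it to
      \<open>k\<close> only decreases the modular.\<close>
    have "luxemburg_norm \<Phi> (ball 0 (real (Suc n))) (\<lambda>x. u x - c n) < ennreal k"
      using bound[of n] M(1) k(1) by simp
    then obtain \<kappa> where \<kappa>: "0 < \<kappa>" "ennreal \<kappa> < ennreal k"
        "orlicz_modular \<Phi> (ball 0 (real (Suc n))) (\<lambda>x. u x - c n) \<kappa> \<le> 1"
      unfolding luxemburg_norm_def INF_less_iff by blast
    then have "\<kappa> \<le> k" using kl by (auto simp: ennreal_less_iff)
    have "orlicz_modular \<Phi> (ball 0 (real (Suc n))) (\<lambda>x. u x - c n) k
        \<le> orlicz_modular \<Phi> (ball 0 (real (Suc n))) (\<lambda>x. u x - c n) \<kappa>"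
      unfolding orlicz_modular_def using \<kappa> \<open>\<kappa> \<le> k\<close> by (intro nn_integral_mono mono) (auto intro: divide_left_mono)
    with \<kappa>(3) show ?thesis by simp
  qed
  let ?f = "\<lambda>n x. \<Phi> (ennreal (\<bar>u x - c n\<bar> / k)) * indicator (ball 0 (real (Suc n))) x"
  \<comment> \<open>Since \<open>k < l\<close>, monotonicity of \<open>\<Phi>\<close> replaces lower semicontinuity.\<close>
  have ptw: "\<Phi> (ennreal (\<bar>u x\<bar> / l)) \<le> liminf (\<lambda>n. ?f n x)" for x
  proof (rule Liminf_bounded)
    \<comment> \<open>Each fixed \<open>x\<close> eventually lies in the balls, so the indicator
      becomes 1.\<close>
    have "\<forall>\<^sub>F n in sequentially. norm x < real n"
      using filterlim_real_sequentially by (simp add: filterlim_at_top_dense)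
    moreover have "\<forall>\<^sub>F n in sequentially. \<bar>u x\<bar> / l \<le> \<bar>u x - c n\<bar> / k"
    \<comment> \<open>The strict gap between the levels is lost where \<open>u x = 0\<close>, but
      there the left side is 0.\<close>
    proof (cases "u x = 0")
      case False
      have "(\<lambda>n. \<bar>u x - c n\<bar> / k) \<longlonglongrightarrow> \<bar>u x - 0\<bar> / k"
        by (intro tendsto_intros c) (use kl in auto)
      moreover have "\<bar>u x\<bar> / l < \<bar>u x - 0\<bar> / k"
        using False kl by (simp add: divide_strict_left_mono)
      ultimately have "\<forall>\<^sub>F n in sequentially. \<bar>u x\<bar> / l < \<bar>u x - c n\<bar> / k"
        by (rule order_tendstoD(1))
      then show ?thesis by (rule eventually_mono) simp
    qed (use kl in simp)
    ultimately show "\<forall>\<^sub>F n in sequentially. \<Phi> (ennreal (\<bar>u x\<bar> / l)) \<le> ?f n x"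
    proof eventually_elim
      case (elim n)
      then show ?case using mono[of "\<bar>u x\<bar> / l" "\<bar>u x - c n\<bar> / k"] kl by simp
    qed
  qed
  have "orlicz_modular \<Phi> UNIV u l \<le> (\<integral>\<^sup>+x. liminf (\<lambda>n. ?f n x) \<partial>lebesgue)"
    using ptw by (simp add: orlicz_modular_restrict nn_integral_mono)
  also have "\<dots> \<le> liminf (\<lambda>n. \<integral>\<^sup>+x. ?f n x \<partial>lebesgue)"
    by (intro nn_integral_liminf borel_measurable_times_ennreal
        borel_measurable_indicator orlicz_integrand_measurable mono)
      (use u in auto)
  also have "\<dots> \<le> liminf (\<lambda>n. 1)"
    using mod by (intro Liminf_mono always_eventually) (simp add: orlicz_modular_restrict)
  finally have "orlicz_modular \<Phi> UNIV u l \<le> 1"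
    by (simp add: Liminf_const)
  then have "luxemburg_norm \<Phi> UNIV u \<le> ennreal l"
    unfolding luxemburg_norm_def using kl by (intro INF_lower) auto
  also have "\<dots> \<le> K'" using L l by simp
  finally show "luxemburg_norm \<Phi> UNIV u \<le> K'" .
qed

section \<open>Growth properties of \<open>phi\<close>\<close>

text \<open>The denominator is the cast of a real number, hence finite; if it is 0, the quotient is
  infinite and still positive.\<close>

lemma phi_pos: "0 < t \<Longrightarrow> 0 < phi \<nu> p (ennreal t)"
  by (simp add: phi_def ennreal_zero_less_divide)

text \<open>With \<open>a = (s / t) powr p\<close>, the point \<open>s powr p\<close> is the convex
  combination of \<open>t powr p\<close> and 0 with weight \<open>a\<close>. Convexity in the
  variable \<open>t powr p\<close> gives the factor \<open>a\<close>, which is at most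
  \<open>s / t\<close> because \<open>1 \<le> p\<close> and \<open>s / t \<le> 1\<close>.\<close>

lemma phi_star_shaped:
  assumes p: "1 \<le> p"
    and young: "young_function (\<lambda>t. phi \<nu> p (ennreal_powr t (1 / p)))"
    and st: "0 \<le> s" "s \<le> t" "0 < t"
  shows "phi \<nu> p (ennreal s) \<le> ennreal (s / t) * phi \<nu> p (ennreal t)"
proof -
  let ?F = "\<lambda>t. phi \<nu> p (ennreal_powr t (1 / p))"
  let ?a = "(s / t) powr p"
  have root: "?F (ennreal (x powr p)) = phi \<nu> p (ennreal x)" if "0 \<le> x" for x
    using that p by (simp add: ennreal_powr_def powr_powr)
  have a1: "?a \<le> s / t"
    using powr_mono'[of 1 p "s / t"] p st by simp
  then have "?a \<le> 1" using st by (meson divide_le_eq_1_pos order_trans)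
  then have "ennreal ?a + ennreal (1 - ?a) = 1"
    by (simp flip: ennreal_plus)
  then have "?F (ennreal ?a * ennreal (t powr p) + ennreal (1 - ?a) * 0)
      \<le> ennreal ?a * ?F (ennreal (t powr p)) + ennreal (1 - ?a) * ?F 0"
    using young unfolding young_function_def by blast
  moreover have "?F 0 = 0" using young by (simp add: young_function_def)
  moreover have "ennreal ?a * ennreal (t powr p) = ennreal (s powr p)"
    using st by (simp add: powr_divide flip: ennreal_mult)
  ultimately have "phi \<nu> p (ennreal s) \<le> ennreal ?a * phi \<nu> p (ennreal t)"
    using root st by simp
  also have "\<dots> \<le> ennreal (s / t) * phi \<nu> p (ennreal t)"
    using a1 by (intro mult_right_mono ennreal_leI) auto
  finally show ?thesis .
qed

theorem theorem4p7:
  fixes \<nu> :: "real ^ 'n \<Rightarrow> real" and p \<Theta> :: real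
  assumes p: "1 \<le> p"
    and \<nu>_nonneg: "\<And>h. h \<noteq> 0 \<Longrightarrow> 0 \<le> \<nu> h"
    and \<nu>_measurable: "\<nu> \<in> borel_measurable (lebesgue_on (- {0}))"
    and \<nu>_integrable: "(\<integral>\<^sup>+h. ennreal (min 1 (norm h powr p) * \<nu> h) \<partial>lebesgue_on (- {0})) < \<infinity>"
    and w: "w_invertible \<nu> p"
    and young: "young_function (\<lambda>t. phi \<nu> p (ennreal_powr t (1 / p)))"
    and \<Theta>: "0 < \<Theta>"
    and poincare_sobolev:
      "\<And>z r u. \<lbrakk>0 < r; u \<in> orlicz_space (phi \<nu> p) (ball z r)\<rbrakk> \<Longrightarrow>
         luxemburg_norm (phi \<nu> p) (ball z r) (\<lambda>x. u x - average (ball z r) u)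
           \<le> ennreal \<Theta> * ennreal_powr (nonlocal_energy \<nu> p (ball z r) u) (1 / p)"
  shows "\<forall>u \<in> orlicz_space (phi \<nu> p) UNIV.
           luxemburg_norm (phi \<nu> p) UNIV u
             \<le> ennreal \<Theta> * ennreal_powr (nonlocal_energy \<nu> p UNIV u) (1 / p)"
proof
  fix u :: "real ^ 'n \<Rightarrow> real"
  assume u: "u \<in> orlicz_space (phi \<nu> p) UNIV"
  note star = phi_star_shaped[OF p young]
  let ?c = "\<lambda>n. average (ball 0 (real (Suc n))) u"
  show "luxemburg_norm (phi \<nu> p) UNIV u
      \<le> ennreal \<Theta> * ennreal_powr (nonlocal_energy \<nu> p UNIV u) (1 / p)"
  proof (rule luxemburg_norm_UNIV_le[where c = ?c])
    show "u \<in> borel_measurable lebesgue"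
      using u by (simp add: orlicz_space_def lebesgue_on_UNIV_eq)
    show "?c \<longlonglongrightarrow> 0"
      by (rule average_ball_tendsto_0[OF star phi_pos u])
    fix n
    let ?B = "ball (0 :: real ^ 'n) (real (Suc n))"
    have "luxemburg_norm (phi \<nu> p) ?B (\<lambda>x. u x - ?c n)
        \<le> ennreal \<Theta> * ennreal_powr (nonlocal_energy \<nu> p ?B u) (1 / p)"
      by (intro poincare_sobolev orlicz_space_subset[OF u]) auto
    \<comment> \<open>Enlarging the domain of the energy makes the bound independent of
      \<open>n\<close>, as the limit lemma requires; it may be infinite.\<close>
    also have "\<dots> \<le> ennreal \<Theta> * ennreal_powr (nonlocal_energy \<nu> p UNIV u) (1 / p)"
      using p by (intro mult_left_mono ennreal_powr_mono nonlocal_energy_mono_set) auto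
    finally show "luxemburg_norm (phi \<nu> p) ?B (\<lambda>x. u x - ?c n)
        \<le> ennreal \<Theta> * ennreal_powr (nonlocal_energy \<nu> p UNIV u) (1 / p)" .
  qed (rule star_shaped_mono[OF star])
qed

end
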